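(* Let $(\Sigma,m)$ be a weighted simplicial complex with locally summable weight $m$, coboundary operator $\delta$ and boundary operator $\partial$. (a) If $\omega\in F^1$ and $\eta\in F^c$, then $$\sum_{\Sigma}m(\delta\partial\omega)\eta=\sum_{\Sigma}m(\partial\omega)(\partial\eta)=\sum_{\Sigma}m\,\omega(\delta\partial\eta).$$ (b) If $\omega\in D(\partial\delta)=\{\varphi\in F:\delta\varphi\in F^1\}$ and $\eta\in F^c$, then $$\sum_{\Sigma}m(\partial\delta\omega)\eta=\sum_{\Sigma}m(\delta\omega)(\delta\eta).$$ (c) If $\omega\in F^{+}=\{\varphi\in F:\sum_{\sigma\succ\tau}m(\sigma)\sum_{\tau'\prec\sigma}|\varphi(\tau')|<\infty\text{ for all }\tau\in\Sigma\}$ and $\eta\in F^c$, then $$\sum_{\Sigma}m(\partial\delta\omega)\eta=\sum_{\Sigma}m\,\omega(\partial\delta\eta).$$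
   Context: Simplicial complex: $V$ is a countable set and $\hat\Sigma$ is a collection of finite subsets of $V$ closed under taking subsets. $\dim\tau=|\tau|-1$, $\hat\Sigma_k=\{\tau\in\hat\Sigma:\dim\tau=k\}$. A weight is a function $m:\hat\Sigma\to(0,\infty)$. Put $\Sigma=\hat\Sigma$ if $\sum_{v\in\hat\Sigma_0}m(v)<\infty$, and $\Sigma=\hat\Sigma\setminus\{\varnothing\}$ otherwise; $\Sigma_k=\hat\Sigma_k\cap\Sigma$. For $\tau,\sigma\in\Sigma$, $\tau\prec\sigma$ (equivalently $\sigma\succ\tau$) means $\tau\subset\sigma$ and $|\sigma\setminus\tau|=1$. All sums are over elements of $\Sigma$. The weight is locally summable if $\sum_{\sigma\succ\tau}m(\sigma)<\infty$ for all $\tau\in\Sigma$. Functions: $F=\mathbb{R}^{\Sigma}$; $F^c\subseteq F$ is the subspace of finitely supported functions; $F^1=\{\omega\in F:\sum_{\sigma\succ\tau}m(\sigma)|\omega(\sigma)|<\infty\text{ for all }\tau\in\Sigma\}$. $\sum_\Sigma f=\sum_{\sigma\in\Sigma}f(\sigma)$ whenever this converges absolutely (absolute convergence is part of the claim). Coboundary operator: a linear map $\delta:F\to F$ with $\delta\delta=0$ such that $\theta(\tau,\sigma):=\delta 1_\tau(\sigma)\in\{-1,0,1\}$, $\theta(\tau,\sigma)\neq0$ iff $\tau\prec\sigma$, and $\delta\omega(\sigma)=\sum_{\tau\prec\sigma}\omega(\tau)\theta(\tau,\sigma)$. Boundary operator: $\partial:D(\partial)=F^1\to F$, $\partial\omega(\rho)=\frac1{m(\rho)}\sum_{\tau\succ\rho}m(\tau)\omega(\tau)\theta(\rho,\tau)$.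 The domain of a composition is $D(AB)=\{f\in D(B):Bf\in D(A)\}$. *)

theory Defs
  imports "HOL-Analysis.Infinite_Sum" "HOL-Library.Countable_Set"
begin

definition simplicial_complex :: "'v set \<Rightarrow> 'v set set \<Rightarrow> bool" where
  "simplicial_complex V Shat \<longleftrightarrow>
     countable V \<and>
     (\<forall>\<tau>\<in>Shat. finite \<tau> \<and> \<tau> \<subseteq> V) \<and>
     (\<forall>\<tau>\<in>Shat. \<forall>\<rho>. \<rho> \<subseteq> \<tau> \<longrightarrow> \<rho> \<in> Shat)"

text \<open>Integer valued, since the empty simplex has dimension -1.\<close>

definition simplex_dim :: "'v set \<Rightarrow> int" where
  "simplex_dim \<tau> = int (card \<tau>) - 1"

definition simplices_of_dim :: "'v set set \<Rightarrow> int \<Rightarrow> 'v set set" where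
  "simplices_of_dim S k = {\<tau> \<in> S. simplex_dim \<tau> = k}"

definition weight :: "'v set set \<Rightarrow> ('v set \<Rightarrow> real) \<Rightarrow> bool" where
  "weight Shat m \<longleftrightarrow> (\<forall>\<tau>\<in>Shat. m \<tau> > 0)"

text \<open>The complex \<open>\<Sigma>\<close> obtained from \<open>Shat\<close>: the empty simplex is kept only if the
  vertices have finite total weight. Below, \<open>S\<close> always stands for \<open>\<Sigma>\<close>.\<close>

definition Sigma_complex :: "'v set set \<Rightarrow> ('v set \<Rightarrow> real) \<Rightarrow> 'v set set" where
  "Sigma_complex Shat m =
     (if m summable_on (simplices_of_dim Shat 0) then Shat else Shat - {{}})"

definition face_rel :: "'v set \<Rightarrow> 'v set \<Rightarrow> bool" (infix "\<prec>" 50) where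
  "\<tau> \<prec> \<sigma> \<longleftrightarrow> \<tau> \<subseteq> \<sigma> \<and> card (\<sigma> - \<tau>) = 1"

definition faces :: "'v set set \<Rightarrow> 'v set \<Rightarrow> 'v set set" where
  "faces S \<sigma> = {\<tau> \<in> S. \<tau> \<prec> \<sigma>}"

definition cofaces :: "'v set set \<Rightarrow> 'v set \<Rightarrow> 'v set set" where
  "cofaces S \<tau> = {\<sigma> \<in> S. \<tau> \<prec> \<sigma>}"

definition locally_summable :: "'v set set \<Rightarrow> ('v set \<Rightarrow> real) \<Rightarrow> bool" where
  "locally_summable S m \<longleftrightarrow> (\<forall>\<tau>\<in>S. m summable_on (cofaces S \<tau>))"

text \<open>A function on \<open>S\<close> is represented by its extension by zero to all sets, so that equality
  in the function space is equality of functions.\<close>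

definition F_all :: "'v set set \<Rightarrow> ('v set \<Rightarrow> real) set" where
  "F_all S = {f. \<forall>\<tau>. \<tau> \<notin> S \<longrightarrow> f \<tau> = 0}"

definition F_c :: "'v set set \<Rightarrow> ('v set \<Rightarrow> real) set" where
  "F_c S = {f \<in> F_all S. finite {\<tau> \<in> S. f \<tau> \<noteq> 0}}"

definition F_1 :: "'v set set \<Rightarrow> ('v set \<Rightarrow> real) \<Rightarrow> ('v set \<Rightarrow> real) set" where
  "F_1 S m = {\<omega> \<in> F_all S. \<forall>\<tau>\<in>S. (\<lambda>\<sigma>. m \<sigma> * \<bar>\<omega> \<sigma>\<bar>) summable_on (cofaces S \<tau>)}"

text \<open>The inner sum ranges over a finite set, as simplices are finite.\<close>

definition F_plus :: "'v set set \<Rightarrow> ('v set \<Rightarrow> real) \<Rightarrow> ('v set \<Rightarrow> real) set" where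
  "F_plus S m = {\<phi> \<in> F_all S. \<forall>\<tau>\<in>S.
     (\<lambda>\<sigma>. m \<sigma> * (\<Sum>\<tau>'\<in>faces S \<sigma>. \<bar>\<phi> \<tau>'\<bar>)) summable_on (cofaces S \<tau>)}"

definition theta ::
  "(('v set \<Rightarrow> real) \<Rightarrow> 'v set \<Rightarrow> real) \<Rightarrow> 'v set \<Rightarrow> 'v set \<Rightarrow> real" where
  "theta \<delta> \<tau> \<sigma> = \<delta> (indicator {\<tau>}) \<sigma>"

definition coboundary_operator ::
  "'v set set \<Rightarrow> (('v set \<Rightarrow> real) \<Rightarrow> 'v set \<Rightarrow> real) \<Rightarrow> bool" where
  "coboundary_operator S \<delta> \<longleftrightarrow>
     (\<forall>f\<in>F_all S. \<delta> f \<in> F_all S) \<and>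
     (\<forall>f\<in>F_all S. \<forall>g\<in>F_all S. \<delta> (\<lambda>\<tau>. f \<tau> + g \<tau>) = (\<lambda>\<tau>. \<delta> f \<tau> + \<delta> g \<tau>)) \<and>
     (\<forall>f\<in>F_all S. \<forall>c. \<delta> (\<lambda>\<tau>. c * f \<tau>) = (\<lambda>\<tau>. c * \<delta> f \<tau>)) \<and>
     (\<forall>f\<in>F_all S. \<delta> (\<delta> f) = (\<lambda>_. 0)) \<and>
     (\<forall>\<tau>\<in>S. \<forall>\<sigma>\<in>S. theta \<delta> \<tau> \<sigma> \<in> {-1, 0, 1} \<and> (theta \<delta> \<tau> \<sigma> \<noteq> 0 \<longleftrightarrow> \<tau> \<prec> \<sigma>)) \<and>
     (\<forall>\<omega>\<in>F_all S. \<forall>\<sigma>\<in>S. \<delta> \<omega> \<sigma> = (\<Sum>\<tau>\<in>faces S \<sigma>. \<omega> \<tau> * theta \<delta> \<tau> \<sigma>))"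

text \<open>The boundary operator has domain \<open>F_1 S m\<close>; its values elsewhere are meaningless.\<close>

definition boundary ::
  "'v set set \<Rightarrow> ('v set \<Rightarrow> real) \<Rightarrow> (('v set \<Rightarrow> real) \<Rightarrow> 'v set \<Rightarrow> real)
     \<Rightarrow> ('v set \<Rightarrow> real) \<Rightarrow> 'v set \<Rightarrow> real" where
  "boundary S m \<delta> \<omega> \<rho> =
     (if \<rho> \<in> S
      then 1 / m \<rho> * (\<Sum>\<^sub>\<infinity>\<tau>\<in>cofaces S \<rho>. m \<tau> * \<omega> \<tau> * theta \<delta> \<rho> \<tau>)
      else 0)"

text \<open>\<open>comp_dom DA DB B\<close> is the domain \<open>D(AB)\<close> for operators with domains \<open>DA\<close> and \<open>DB\<close>.\<close>

definition comp_dom :: "'b set \<Rightarrow> 'a set \<Rightarrow> ('a \<Rightarrow> 'b) \<Rightarrow> 'a set" where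
  "comp_dom DA DB B = {f \<in> DB. B f \<in> DA}"

definition dom_delta_boundary ::
  "'v set set \<Rightarrow> ('v set \<Rightarrow> real) \<Rightarrow> (('v set \<Rightarrow> real) \<Rightarrow> 'v set \<Rightarrow> real)
     \<Rightarrow> ('v set \<Rightarrow> real) set" where
  "dom_delta_boundary S m \<delta> = comp_dom (F_all S) (F_1 S m) (boundary S m \<delta>)"

definition dom_boundary_delta ::
  "'v set set \<Rightarrow> ('v set \<Rightarrow> real) \<Rightarrow> (('v set \<Rightarrow> real) \<Rightarrow> 'v set \<Rightarrow> real)
     \<Rightarrow> ('v set \<Rightarrow> real) set" where
  "dom_boundary_delta S m \<delta> = comp_dom (F_1 S m) (F_all S) \<delta>"

end

(*
All identities are instances of one exchange of summation: for f, g in F,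
  sum over (tau, sigma) of  m(sigma) f(sigma) g(tau) theta(tau, sigma)
equals both  sum m (bd f) g  and  sum m f (delta g)  as soon as
  sum over sigma of  m(sigma) |f(sigma)| sum over tau < sigma of |g(tau)|
is finite. This holds when f has finite support (simplices have finitely many faces), when f is
in F^1 and g has finite support, and when g is in F^+ and f = delta eta with eta of finite
support, since then |f(sigma)| is at most the sum of |eta| over the faces of sigma.
*)
theory Submission
  imports Defs
begin

section \<open>Summability against functions of finite support\<close>

lemma finite_faces:
  assumes "finite \<sigma>"
  shows "finite (faces S \<sigma>)"
  by (rule finite_subset[of _ "Pow \<sigma>"]) (use assms in \<open>auto simp: faces_def face_rel_def\<close>)

text \<open>The face sum of \<open>g\<close> sees only the finite support of \<open>g\<close>.
  Expanding it leaves finitely many copies of \<open>h\<close>, each restricted to the cofaces of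
  one simplex and scaled. The function \<open>h\<close> is kept general because it later stands for
  \<open>m\<close>, for \<open>m\<close> times an absolute value, and for \<open>m\<close> times a
  second face sum.\<close>

lemma summable_on_mult_faces_sum:
  fixes h g :: "'v set \<Rightarrow> real"
  assumes fin: "\<And>\<sigma>. \<sigma> \<in> S \<Longrightarrow> finite \<sigma>"
    and h: "\<And>\<rho>. \<rho> \<in> S \<Longrightarrow> h summable_on (cofaces S \<rho>)"
    and g: "g \<in> F_c S"
  shows "(\<lambda>\<sigma>. h \<sigma> * (\<Sum>\<tau>\<in>faces S \<sigma>. \<bar>g \<tau>\<bar>)) summable_on S"
proof -
  define T where "T = {\<tau> \<in> S. g \<tau> \<noteq> 0}"
  have T: "finite T" "T \<subseteq> S"
    using g by (auto simp: T_def F_c_def)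
  \<comment> \<open>Extension by zero off the cofaces of \<open>\<rho>\<close> puts all summands on
    the common index set \<open>S\<close>, so that they can be added.\<close>
  have "(\<lambda>\<sigma>. if \<rho> \<prec> \<sigma> then h \<sigma> * \<bar>g \<rho>\<bar> else 0) summable_on S" if "\<rho> \<in> T" for \<rho>
  proof -
    have "(\<lambda>\<sigma>. h \<sigma> * \<bar>g \<rho>\<bar>) summable_on (cofaces S \<rho>)"
      using h T that by (intro summable_on_cmult_left) auto
    then show ?thesis
      by (rule summable_on_cong_neutral[THEN iffD1, rotated -1]) (auto simp: cofaces_def)
  qed
  with \<open>finite T\<close>
  have "(\<lambda>\<sigma>. \<Sum>\<rho>\<in>T. if \<rho> \<prec> \<sigma> then h \<sigma> * \<bar>g \<rho>\<bar> else 0) summable_on S"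
    by (induction T rule: finite_induct) (auto intro: summable_on_add)
  moreover have "(\<Sum>\<rho>\<in>T. if \<rho> \<prec> \<sigma> then h \<sigma> * \<bar>g \<rho>\<bar> else 0) = h \<sigma> * (\<Sum>\<tau>\<in>faces S \<sigma>. \<bar>g \<tau>\<bar>)"
    if "\<sigma> \<in> S" for \<sigma>
  proof -
    \<comment> \<open>Elements of \<open>T\<close> that are not faces of \<open>\<sigma>\<close>
      contribute 0; the faces outside \<open>T\<close> can then be put back, since \<open>g\<close>
      vanishes there.\<close>
    have "(\<Sum>\<rho>\<in>T. if \<rho> \<prec> \<sigma> then h \<sigma> * \<bar>g \<rho>\<bar> else 0) = (\<Sum>\<rho>\<in>T \<inter> faces S \<sigma>. h \<sigma> * \<bar>g \<rho>\<bar>)"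
      using T by (intro sum.mono_neutral_cong_right) (auto simp: faces_def)
    also have "\<dots> = (\<Sum>\<rho>\<in>faces S \<sigma>. h \<sigma> * \<bar>g \<rho>\<bar>)"
      using finite_faces[OF fin[OF that]]
      by (intro sum.mono_neutral_left) (auto simp: faces_def T_def)
    finally show ?thesis
      by (simp add: sum_distrib_left)
  qed
  ultimately show ?thesis
    by (simp cong: summable_on_cong)
qed

section \<open>Bounds, supports and domains of the two operators\<close>

text \<open>Collects what \<open>S\<close> inherits from the complex whether or not the empty
  simplex is kept: finite simplices make face sums finite, and positive weights allow division by
  \<open>m\<close> and comparison of weighted sums.\<close>

locale weighted_coboundary =
  fixes S :: "'v set set" and m :: "'v set \<Rightarrow> real"
    and \<delta> :: "('v set \<Rightarrow> real) \<Rightarrow> 'v set \<Rightarrow> real"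
  assumes finite_simplex: "\<sigma> \<in> S \<Longrightarrow> finite \<sigma>"
    and weight_pos: "\<sigma> \<in> S \<Longrightarrow> m \<sigma> > 0"
    and coboundary: "coboundary_operator S \<delta>"
begin

abbreviation bd :: "('v set \<Rightarrow> real) \<Rightarrow> 'v set \<Rightarrow> real" where
  "bd \<equiv> boundary S m \<delta>"

lemma abs_theta_le:
  assumes "\<tau> \<in> S" "\<sigma> \<in> S"
  shows "\<bar>theta \<delta> \<tau> \<sigma>\<bar> \<le> 1"
proof -
  have "theta \<delta> \<tau> \<sigma> \<in> {-1, 0, 1}"
    using coboundary assms unfolding coboundary_operator_def by blast
  then show ?thesis
    by auto
qed

lemma theta_eq_0: "\<tau> \<in> S \<Longrightarrow> \<sigma> \<in> S \<Longrightarrow> \<not> \<tau> \<prec> \<sigma> \<Longrightarrow> theta \<delta> \<tau> \<sigma> = 0"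
  using coboundary unfolding coboundary_operator_def by blast

lemma delta_in_F_all: "f \<in> F_all S \<Longrightarrow> \<delta> f \<in> F_all S"
  using coboundary unfolding coboundary_operator_def by blast

lemma delta_eq:
  "f \<in> F_all S \<Longrightarrow> \<sigma> \<in> S \<Longrightarrow> \<delta> f \<sigma> = (\<Sum>\<tau>\<in>faces S \<sigma>. f \<tau> * theta \<delta> \<tau> \<sigma>)"
  using coboundary unfolding coboundary_operator_def by blast

text \<open>Triangle inequality, with each incidence sign bounded by 1.\<close>

lemma abs_delta_le:
  assumes "f \<in> F_all S" "\<sigma> \<in> S"
  shows "\<bar>\<delta> f \<sigma>\<bar> \<le> (\<Sum>\<tau>\<in>faces S \<sigma>. \<bar>f \<tau>\<bar>)"
  unfolding delta_eq[OF assms]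
  by (rule order_trans[OF sum_abs])
    (auto intro!: sum_mono mult_left_le simp: abs_mult abs_theta_le assms faces_def)

text \<open>The default value 0 off \<open>S\<close> in \<open>boundary\<close> gives this for every
  \<open>f\<close>; hence \<open>dom_delta_boundary\<close> is all of
  \<open>F_1 S m\<close>.\<close>

lemma bd_in_F_all: "bd f \<in> F_all S"
  by (simp add: F_all_def boundary_def)

text \<open>The value at \<open>\<rho>\<close> can be nonzero only if \<open>\<rho>\<close> is a
  face of a simplex in the support of \<open>f\<close>, and finitely many simplices have finitely
  many faces in total. This lets \<open>bd \<eta>\<close> serve as a function of finite support in
  the first identity.\<close>

lemma bd_in_F_c:
  assumes "f \<in> F_c S"
  shows "bd f \<in> F_c S"
proof -
  have "bd f \<rho> = 0" if "\<rho> \<in> S" "\<And>\<sigma>. \<sigma> \<in> S \<Longrightarrow> f \<sigma> \<noteq> 0 \<Longrightarrow> \<not> \<rho> \<prec> \<sigma>" for \<rho>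
  proof -
    have "(\<Sum>\<^sub>\<infinity>\<tau>\<in>cofaces S \<rho>. m \<tau> * f \<tau> * theta \<delta> \<rho> \<tau>) = 0"
      using that by (intro infsum_0) (auto simp: cofaces_def)
    then show ?thesis
      by (simp add: boundary_def)
  qed
  then have "{\<rho> \<in> S. bd f \<rho> \<noteq> 0} \<subseteq> (\<Union>\<sigma>\<in>{\<sigma> \<in> S. f \<sigma> \<noteq> 0}. faces S \<sigma>)"
    by (fastforce simp: faces_def)
  moreover have "finite (\<Union>\<sigma>\<in>{\<sigma> \<in> S. f \<sigma> \<noteq> 0}. faces S \<sigma>)"
    using assms by (auto simp: F_c_def intro: finite_faces finite_simplex)
  ultimately show ?thesis
    by (simp add: F_c_def bd_in_F_all finite_subset)
qed

lemma F_c_subset_F_1: "F_c S \<subseteq> F_1 S m"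
proof
  fix f assume f: "f \<in> F_c S"
  have "(\<lambda>\<sigma>. m \<sigma> * \<bar>f \<sigma>\<bar>) summable_on cofaces S \<tau>" for \<tau>
    using f by (intro finite_nonzero_values_imp_summable_on)
      (auto simp: F_c_def cofaces_def elim!: rev_finite_subset)
  then show "f \<in> F_1 S m"
    using f by (simp add: F_1_def F_c_def)
qed

text \<open>Local summability enters here, as the coface condition of
  \<open>summable_on_mult_faces_sum\<close> with \<open>h\<close> equal to \<open>m\<close>. That
  lemma gives summability over all of \<open>S\<close>, which is then restricted to cofaces.\<close>

lemma F_c_subset_F_plus:
  assumes "locally_summable S m"
  shows "F_c S \<subseteq> F_plus S m"
proof
  fix f assume f: "f \<in> F_c S"
  have "(\<lambda>\<sigma>. m \<sigma> * (\<Sum>\<tau>\<in>faces S \<sigma>. \<bar>f \<tau>\<bar>)) summable_on S"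
    using assms f finite_simplex
    by (intro summable_on_mult_faces_sum) (auto simp: locally_summable_def)
  then have "(\<lambda>\<sigma>. m \<sigma> * (\<Sum>\<tau>\<in>faces S \<sigma>. \<bar>f \<tau>\<bar>)) summable_on cofaces S \<rho>" for \<rho>
    by (rule summable_on_subset_banach) (auto simp: cofaces_def)
  then show "f \<in> F_plus S m"
    using f by (simp add: F_plus_def F_c_def)
qed

text \<open>By \<open>abs_delta_le\<close>, the weighted face sums in the definition of
  \<open>F_plus\<close> dominate \<open>m\<close> times the absolute value of
  \<open>\<delta> f\<close>.\<close>

lemma F_plus_subset_dom: "F_plus S m \<subseteq> dom_boundary_delta S m \<delta>"
proof
  fix f assume f: "f \<in> F_plus S m"
  then have fF: "f \<in> F_all S"
    by (simp add: F_plus_def)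
  have "(\<lambda>\<sigma>. m \<sigma> * \<bar>\<delta> f \<sigma>\<bar>) summable_on cofaces S \<rho>" if "\<rho> \<in> S" for \<rho>
  proof (rule summable_on_comparison_test)
    show "(\<lambda>\<sigma>. m \<sigma> * (\<Sum>\<tau>\<in>faces S \<sigma>. \<bar>f \<tau>\<bar>)) summable_on cofaces S \<rho>"
      using f that by (simp add: F_plus_def)
  qed (use fF in \<open>auto simp: cofaces_def weight_pos less_imp_le abs_delta_le intro!: mult_left_mono\<close>)
  then show "f \<in> dom_boundary_delta S m \<delta>"
    using fF by (simp add: dom_boundary_delta_def comp_dom_def F_1_def delta_in_F_all)
qed

section \<open>Exchange of summation\<close>

text \<open>Fubini for the kernel \<open>k\<close> on pairs of simplices: its row sums pair
  \<open>f\<close> with \<open>\<delta> g\<close>, its column sums pair \<open>bd f\<close> with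
  \<open>g\<close>.\<close>

lemma adjointness:
  assumes g: "g \<in> F_all S"
    and summable: "(\<lambda>\<sigma>. m \<sigma> * \<bar>f \<sigma>\<bar> * (\<Sum>\<tau>\<in>faces S \<sigma>. \<bar>g \<tau>\<bar>)) summable_on S"
  shows "(\<lambda>\<tau>. m \<tau> * bd f \<tau> * g \<tau>) abs_summable_on S"
    and "(\<lambda>\<sigma>. m \<sigma> * f \<sigma> * \<delta> g \<sigma>) abs_summable_on S"
    and "(\<Sum>\<^sub>\<infinity>\<tau>\<in>S. m \<tau> * bd f \<tau> * g \<tau>) = (\<Sum>\<^sub>\<infinity>\<sigma>\<in>S. m \<sigma> * f \<sigma> * \<delta> g \<sigma>)"
proof -
  define k where "k \<sigma> \<tau> = m \<sigma> * f \<sigma> * (g \<tau> * theta \<delta> \<tau> \<sigma>)" for \<sigma> \<tau>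
  have k0: "k \<sigma> \<tau> = 0" if "\<sigma> \<in> S" "\<tau> \<in> S" "\<not> \<tau> \<prec> \<sigma>" for \<sigma> \<tau>
    using that by (simp add: k_def theta_eq_0)
  \<comment> \<open>Stated for a general \<open>F\<close> to cover both the identity, which gives
    the value of a row, and \<open>abs\<close>, which gives its absolute sum. The condition at 0
    discards everything but the finitely many faces.\<close>
  have row_sum: "(\<Sum>\<^sub>\<infinity>\<tau>\<in>S. F (k \<sigma> \<tau>)) = (\<Sum>\<tau>\<in>faces S \<sigma>. F (k \<sigma> \<tau>))"
    if "\<sigma> \<in> S" "F 0 = 0" for \<sigma> and F :: "real \<Rightarrow> real"
  proof -
    have "(\<Sum>\<^sub>\<infinity>\<tau>\<in>S. F (k \<sigma> \<tau>)) = (\<Sum>\<^sub>\<infinity>\<tau>\<in>faces S \<sigma>. F (k \<sigma> \<tau>))"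
      using that k0 by (intro infsum_cong_neutral) (auto simp: faces_def)
    then show ?thesis
      using finite_faces[OF finite_simplex] that by simp
  qed
  have row: "(\<Sum>\<^sub>\<infinity>\<tau>\<in>S. k \<sigma> \<tau>) = m \<sigma> * f \<sigma> * \<delta> g \<sigma>" if "\<sigma> \<in> S" for \<sigma>
    using row_sum[OF that, of "\<lambda>x. x"] that g by (simp add: k_def delta_eq sum_distrib_left)
  have col: "(\<Sum>\<^sub>\<infinity>\<sigma>\<in>S. k \<sigma> \<tau>) = m \<tau> * bd f \<tau> * g \<tau>" if "\<tau> \<in> S" for \<tau>
  proof -
    have "(\<Sum>\<^sub>\<infinity>\<sigma>\<in>S. k \<sigma> \<tau>) = (\<Sum>\<^sub>\<infinity>\<sigma>\<in>cofaces S \<tau>. m \<sigma> * f \<sigma> * theta \<delta> \<tau> \<sigma> * g \<tau>)"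
      using that k0 by (intro infsum_cong_neutral) (auto simp: cofaces_def k_def)
    \<comment> \<open>The unconditional form of the rule matters: where \<open>g \<tau> = 0\<close>,
      the hypothesis says nothing about \<open>f\<close> on the cofaces of \<open>\<tau>\<close>,
      yet both sides are 0.\<close>
    also have "\<dots> = (\<Sum>\<^sub>\<infinity>\<sigma>\<in>cofaces S \<tau>. m \<sigma> * f \<sigma> * theta \<delta> \<tau> \<sigma>) * g \<tau>"
      by (rule infsum_cmult_left')
    also have "\<dots> = m \<tau> * bd f \<tau> * g \<tau>"
      using weight_pos[OF that] that by (simp add: boundary_def)
    finally show ?thesis .
  qed
  \<comment> \<open>Checked row by row: each row has finite support, and \<open>abs_theta_le\<close>
    bounds its absolute sum by the function assumed summable.\<close>
  have "(\<lambda>(\<sigma>, \<tau>). k \<sigma> \<tau>) abs_summable_on S \<times> S"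
    unfolding abs_summable_on_Sigma_iff
  proof (intro conjI ballI; simp)
    fix \<sigma> assume \<sigma>: "\<sigma> \<in> S"
    have "{\<tau> \<in> S. \<bar>k \<sigma> \<tau>\<bar> \<noteq> 0} \<subseteq> faces S \<sigma>"
      using k0 \<sigma> by (auto simp: faces_def)
    then show "(\<lambda>\<tau>. \<bar>k \<sigma> \<tau>\<bar>) summable_on S"
      using finite_faces[OF finite_simplex[OF \<sigma>]]
      by (intro finite_nonzero_values_imp_summable_on) (rule finite_subset)
  next
    show "(\<lambda>\<sigma>. \<bar>\<Sum>\<^sub>\<infinity>\<tau>\<in>S. \<bar>k \<sigma> \<tau>\<bar>\<bar>) summable_on S"
    proof (rule summable_on_comparison_test[OF summable])
      fix \<sigma> assume \<sigma>: "\<sigma> \<in> S"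
      have "\<bar>\<Sum>\<^sub>\<infinity>\<tau>\<in>S. \<bar>k \<sigma> \<tau>\<bar>\<bar> = (\<Sum>\<tau>\<in>faces S \<sigma>. \<bar>k \<sigma> \<tau>\<bar>)"
        using row_sum[OF \<sigma>, of abs] by (simp add: sum_nonneg)
      also have "\<dots> \<le> (\<Sum>\<tau>\<in>faces S \<sigma>. m \<sigma> * \<bar>f \<sigma>\<bar> * \<bar>g \<tau>\<bar>)"
        using \<sigma> weight_pos[OF \<sigma>] abs_theta_le
        by (intro sum_mono) (auto simp: k_def abs_mult faces_def intro!: mult_left_mono mult_left_le)
      finally show "\<bar>\<Sum>\<^sub>\<infinity>\<tau>\<in>S. \<bar>k \<sigma> \<tau>\<bar>\<bar> \<le> m \<sigma> * \<bar>f \<sigma>\<bar> * (\<Sum>\<tau>\<in>faces S \<sigma>. \<bar>g \<tau>\<bar>)"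
        by (simp add: sum_distrib_left)
    qed simp
  qed
  then have k: "(\<lambda>(\<sigma>, \<tau>). k \<sigma> \<tau>) summable_on S \<times> S"
    by (rule abs_summable_summable)
  \<comment> \<open>Transposed so that columns become the inner sums.\<close>
  then have k': "(\<lambda>(\<tau>, \<sigma>). k \<sigma> \<tau>) summable_on S \<times> S"
    by (subst (asm) summable_on_swap) (simp add: case_prod_unfold)
  \<comment> \<open>Inner sums of a summable family are summable, and for real values this is
    already absolute summability.\<close>
  have "(\<lambda>\<sigma>. m \<sigma> * f \<sigma> * \<delta> g \<sigma>) summable_on S"
    using summable_on_Sigma_banach[OF k] row by (simp cong: summable_on_cong)
  then show "(\<lambda>\<sigma>. m \<sigma> * f \<sigma> * \<delta> g \<sigma>) abs_summable_on S"
    by (rule summable_on_iff_abs_summable_on_real[THEN iffD1])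
  have "(\<lambda>\<tau>. m \<tau> * bd f \<tau> * g \<tau>) summable_on S"
    using summable_on_Sigma_banach[OF k'] col by (simp cong: summable_on_cong)
  then show "(\<lambda>\<tau>. m \<tau> * bd f \<tau> * g \<tau>) abs_summable_on S"
    by (rule summable_on_iff_abs_summable_on_real[THEN iffD1])
  show "(\<Sum>\<^sub>\<infinity>\<tau>\<in>S. m \<tau> * bd f \<tau> * g \<tau>) = (\<Sum>\<^sub>\<infinity>\<sigma>\<in>S. m \<sigma> * f \<sigma> * \<delta> g \<sigma>)"
    using infsum_swap_banach[OF k] row col by (simp cong: infsum_cong)
qed

section \<open>Pairs of functions for which the exchange is allowed\<close>

lemma summable_F_1_F_c:
  assumes "f \<in> F_1 S m" "g \<in> F_c S"
  shows "(\<lambda>\<sigma>. m \<sigma> * \<bar>f \<sigma>\<bar> * (\<Sum>\<tau>\<in>faces S \<sigma>. \<bar>g \<tau>\<bar>)) summable_on S"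
  using assms finite_simplex by (intro summable_on_mult_faces_sum) (auto simp: F_1_def)

text \<open>The product vanishes off the support of \<open>f\<close>, so \<open>g\<close> may grow
  arbitrarily, as \<open>bd \<omega>\<close> may in the first identity.\<close>

lemma summable_F_c_F_all:
  assumes "f \<in> F_c S"
  shows "(\<lambda>\<sigma>. m \<sigma> * \<bar>f \<sigma>\<bar> * (\<Sum>\<tau>\<in>faces S \<sigma>. \<bar>g \<tau>\<bar>)) summable_on S"
  using assms by (intro finite_nonzero_values_imp_summable_on)
    (auto simp: F_c_def elim!: rev_finite_subset)

text \<open>A simplex may have infinitely many cofaces, so \<open>\<delta> f\<close> can have
  infinite support. Bounding it by the face sum of \<open>f\<close> brings back a finite support,
  and the face sum of \<open>g\<close>, controlled by \<open>F_plus\<close>, goes into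
  \<open>h\<close>.\<close>

lemma summable_delta_F_c_F_plus:
  assumes f: "f \<in> F_c S" and g: "g \<in> F_plus S m"
  shows "(\<lambda>\<sigma>. m \<sigma> * \<bar>\<delta> f \<sigma>\<bar> * (\<Sum>\<tau>\<in>faces S \<sigma>. \<bar>g \<tau>\<bar>)) summable_on S"
proof (rule summable_on_comparison_test)
  show "(\<lambda>\<sigma>. m \<sigma> * (\<Sum>\<tau>\<in>faces S \<sigma>. \<bar>g \<tau>\<bar>) * (\<Sum>\<tau>\<in>faces S \<sigma>. \<bar>f \<tau>\<bar>)) summable_on S"
    using f g finite_simplex by (intro summable_on_mult_faces_sum) (auto simp: F_plus_def)
next
  fix \<sigma> assume \<sigma>: "\<sigma> \<in> S"
  have "\<bar>\<delta> f \<sigma>\<bar> \<le> (\<Sum>\<tau>\<in>faces S \<sigma>. \<bar>f \<tau>\<bar>)"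
    using f \<sigma> by (intro abs_delta_le) (auto simp: F_c_def)
  then have "m \<sigma> * (\<Sum>\<tau>\<in>faces S \<sigma>. \<bar>g \<tau>\<bar>) * \<bar>\<delta> f \<sigma>\<bar>
      \<le> m \<sigma> * (\<Sum>\<tau>\<in>faces S \<sigma>. \<bar>g \<tau>\<bar>) * (\<Sum>\<tau>\<in>faces S \<sigma>. \<bar>f \<tau>\<bar>)"
    using weight_pos[OF \<sigma>] by (intro mult_left_mono) (auto intro!: mult_nonneg_nonneg sum_nonneg)
  then show "m \<sigma> * \<bar>\<delta> f \<sigma>\<bar> * (\<Sum>\<tau>\<in>faces S \<sigma>. \<bar>g \<tau>\<bar>)
      \<le> m \<sigma> * (\<Sum>\<tau>\<in>faces S \<sigma>. \<bar>g \<tau>\<bar>) * (\<Sum>\<tau>\<in>faces S \<sigma>. \<bar>f \<tau>\<bar>)"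
    by (simp add: mult_ac)
  show "0 \<le> m \<sigma> * \<bar>\<delta> f \<sigma>\<bar> * (\<Sum>\<tau>\<in>faces S \<sigma>. \<bar>g \<tau>\<bar>)"
    using weight_pos[OF \<sigma>] by (auto intro!: mult_nonneg_nonneg sum_nonneg)
qed

end

section \<open>The three Green formulas, with domains and absolute convergence\<close>

theorem theorem2p11:
  fixes V :: "'v set" and Shat S :: "'v set set" and m :: "'v set \<Rightarrow> real"
    and \<delta> bd :: "('v set \<Rightarrow> real) \<Rightarrow> 'v set \<Rightarrow> real"
  assumes "simplicial_complex V Shat"
    and "weight Shat m"
    and "S = Sigma_complex Shat m"
    and "locally_summable S m"
    and "coboundary_operator S \<delta>"
    and "bd = boundary S m \<delta>"
  shows
    "(\<forall>\<omega>\<in>F_1 S m. \<forall>\<eta>\<in>F_c S.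
        \<omega> \<in> dom_delta_boundary S m \<delta> \<and> \<eta> \<in> dom_delta_boundary S m \<delta> \<and>
        (\<lambda>\<sigma>. m \<sigma> * \<delta> (bd \<omega>) \<sigma> * \<eta> \<sigma>) abs_summable_on S \<and>
        (\<lambda>\<sigma>. m \<sigma> * bd \<omega> \<sigma> * bd \<eta> \<sigma>) abs_summable_on S \<and>
        (\<lambda>\<sigma>. m \<sigma> * \<omega> \<sigma> * \<delta> (bd \<eta>) \<sigma>) abs_summable_on S \<and>
        (\<Sum>\<^sub>\<infinity>\<sigma>\<in>S. m \<sigma> * \<delta> (bd \<omega>) \<sigma> * \<eta> \<sigma>) = (\<Sum>\<^sub>\<infinity>\<sigma>\<in>S. m \<sigma> * bd \<omega> \<sigma> * bd \<eta> \<sigma>) \<and>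
        (\<Sum>\<^sub>\<infinity>\<sigma>\<in>S. m \<sigma> * bd \<omega> \<sigma> * bd \<eta> \<sigma>) = (\<Sum>\<^sub>\<infinity>\<sigma>\<in>S. m \<sigma> * \<omega> \<sigma> * \<delta> (bd \<eta>) \<sigma>)) \<and>
     (\<forall>\<omega>\<in>dom_boundary_delta S m \<delta>. \<forall>\<eta>\<in>F_c S.
        (\<lambda>\<sigma>. m \<sigma> * bd (\<delta> \<omega>) \<sigma> * \<eta> \<sigma>) abs_summable_on S \<and>
        (\<lambda>\<sigma>. m \<sigma> * \<delta> \<omega> \<sigma> * \<delta> \<eta> \<sigma>) abs_summable_on S \<and>
        (\<Sum>\<^sub>\<infinity>\<sigma>\<in>S. m \<sigma> * bd (\<delta> \<omega>) \<sigma> * \<eta> \<sigma>) = (\<Sum>\<^sub>\<infinity>\<sigma>\<in>S. m \<sigma> * \<delta> \<omega> \<sigma> * \<delta> \<eta> \<sigma>)) \<and>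
     (\<forall>\<omega>\<in>F_plus S m. \<forall>\<eta>\<in>F_c S.
        \<omega> \<in> dom_boundary_delta S m \<delta> \<and> \<eta> \<in> dom_boundary_delta S m \<delta> \<and>
        (\<lambda>\<sigma>. m \<sigma> * bd (\<delta> \<omega>) \<sigma> * \<eta> \<sigma>) abs_summable_on S \<and>
        (\<lambda>\<sigma>. m \<sigma> * \<omega> \<sigma> * bd (\<delta> \<eta>) \<sigma>) abs_summable_on S \<and>
        (\<Sum>\<^sub>\<infinity>\<sigma>\<in>S. m \<sigma> * bd (\<delta> \<omega>) \<sigma> * \<eta> \<sigma>) = (\<Sum>\<^sub>\<infinity>\<sigma>\<in>S. m \<sigma> * \<omega> \<sigma> * bd (\<delta> \<eta>) \<sigma>))"
proof -
  have S: "S \<subseteq> Shat"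
    using assms(3) by (auto simp: Sigma_complex_def split: if_splits)
  interpret weighted_coboundary S m \<delta>
    using assms(1,2,5) S by unfold_locales (auto simp: simplicial_complex_def weight_def)
  have bd: "bd = boundary S m \<delta>"
    by (fact assms(6))
  have F_c_F_all: "\<eta> \<in> F_all S" if "\<eta> \<in> F_c S" for \<eta>
    using that by (simp add: F_c_def)
  show ?thesis
    unfolding bd
  proof (intro conjI ballI)
    fix \<omega> \<eta> assume \<omega>: "\<omega> \<in> F_1 S m" and \<eta>: "\<eta> \<in> F_c S"
    \<comment> \<open>The exchange for the pair \<open>\<eta>\<close>, \<open>bd \<omega>\<close>
      and then for \<open>\<omega>\<close>, \<open>bd \<eta>\<close>; both produce the middle sum
      with \<open>bd \<omega>\<close> and \<open>bd \<eta>\<close>.\<close>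
    note 1 = adjointness[OF bd_in_F_all summable_F_c_F_all[OF \<eta>], of \<omega>]
    note 2 = adjointness[OF bd_in_F_all summable_F_1_F_c[OF \<omega> bd_in_F_c[OF \<eta>]]]
    show "\<omega> \<in> dom_delta_boundary S m \<delta>" "\<eta> \<in> dom_delta_boundary S m \<delta>"
      using \<omega> \<eta> F_c_subset_F_1 bd_in_F_all by (auto simp: dom_delta_boundary_def comp_dom_def)
    show "(\<lambda>\<sigma>. m \<sigma> * \<delta> (boundary S m \<delta> \<omega>) \<sigma> * \<eta> \<sigma>) abs_summable_on S"
      using 1(2) by (simp add: mult_ac)
    show "(\<lambda>\<sigma>. m \<sigma> * boundary S m \<delta> \<omega> \<sigma> * boundary S m \<delta> \<eta> \<sigma>) abs_summable_on S"
      by (fact 2(1))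
    show "(\<lambda>\<sigma>. m \<sigma> * \<omega> \<sigma> * \<delta> (boundary S m \<delta> \<eta>) \<sigma>) abs_summable_on S"
      by (fact 2(2))
    show "(\<Sum>\<^sub>\<infinity>\<sigma>\<in>S. m \<sigma> * \<delta> (boundary S m \<delta> \<omega>) \<sigma> * \<eta> \<sigma>)
        = (\<Sum>\<^sub>\<infinity>\<sigma>\<in>S. m \<sigma> * boundary S m \<delta> \<omega> \<sigma> * boundary S m \<delta> \<eta> \<sigma>)"
      using 1(3) by (simp add: mult_ac)
    show "(\<Sum>\<^sub>\<infinity>\<sigma>\<in>S. m \<sigma> * boundary S m \<delta> \<omega> \<sigma> * boundary S m \<delta> \<eta> \<sigma>)
        = (\<Sum>\<^sub>\<infinity>\<sigma>\<in>S. m \<sigma> * \<omega> \<sigma> * \<delta> (boundary S m \<delta> \<eta>) \<sigma>)"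
      by (fact 2(3))
  next
    fix \<omega> \<eta> assume \<omega>: "\<omega> \<in> dom_boundary_delta S m \<delta>" and \<eta>: "\<eta> \<in> F_c S"
    have "\<delta> \<omega> \<in> F_1 S m"
      using \<omega> by (simp add: dom_boundary_delta_def comp_dom_def)
    \<comment> \<open>A single exchange, for the pair \<open>\<delta> \<omega>\<close>,
      \<open>\<eta>\<close>.\<close>
    note 1 = adjointness[OF F_c_F_all[OF \<eta>] summable_F_1_F_c[OF this \<eta>]]
    show "(\<lambda>\<sigma>. m \<sigma> * boundary S m \<delta> (\<delta> \<omega>) \<sigma> * \<eta> \<sigma>) abs_summable_on S"
      "(\<lambda>\<sigma>. m \<sigma> * \<delta> \<omega> \<sigma> * \<delta> \<eta> \<sigma>) abs_summable_on S"
      "(\<Sum>\<^sub>\<infinity>\<sigma>\<in>S. m \<sigma> * boundary S m \<delta> (\<delta> \<omega>) \<sigma> * \<eta> \<sigma>)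
        = (\<Sum>\<^sub>\<infinity>\<sigma>\<in>S. m \<sigma> * \<delta> \<omega> \<sigma> * \<delta> \<eta> \<sigma>)"
      by (fact 1)+
  next
    fix \<omega> \<eta> assume \<omega>: "\<omega> \<in> F_plus S m" and \<eta>: "\<eta> \<in> F_c S"
    show \<omega>_dom: "\<omega> \<in> dom_boundary_delta S m \<delta>" and "\<eta> \<in> dom_boundary_delta S m \<delta>"
      using \<omega> \<eta> F_plus_subset_dom F_c_subset_F_plus[OF assms(4)] by auto
    have "\<delta> \<omega> \<in> F_1 S m" and \<omega>_all: "\<omega> \<in> F_all S"
      using \<omega>_dom by (simp_all add: dom_boundary_delta_def comp_dom_def)
    \<comment> \<open>Both sides are compared with the sum of \<open>m\<close> times
      \<open>\<delta> \<omega>\<close> times \<open>\<delta> \<eta>\<close>: the first exchange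
      moves \<open>\<delta>\<close> off \<open>\<eta>\<close>, the second moves it off
      \<open>\<omega>\<close>.\<close>
    note 1 = adjointness[OF F_c_F_all[OF \<eta>] summable_F_1_F_c[OF this(1) \<eta>]]
    note 2 = adjointness[OF \<omega>_all summable_delta_F_c_F_plus[OF \<eta> \<omega>]]
    show "(\<lambda>\<sigma>. m \<sigma> * boundary S m \<delta> (\<delta> \<omega>) \<sigma> * \<eta> \<sigma>) abs_summable_on S"
      by (fact 1(1))
    show "(\<lambda>\<sigma>. m \<sigma> * \<omega> \<sigma> * boundary S m \<delta> (\<delta> \<eta>) \<sigma>) abs_summable_on S"
      using 2(1) by (simp add: mult_ac)
    show "(\<Sum>\<^sub>\<infinity>\<sigma>\<in>S. m \<sigma> * boundary S m \<delta> (\<delta> \<omega>) \<sigma> * \<eta> \<sigma>)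
        = (\<Sum>\<^sub>\<infinity>\<sigma>\<in>S. m \<sigma> * \<omega> \<sigma> * boundary S m \<delta> (\<delta> \<eta>) \<sigma>)"
      using 1(3) 2(3) by (simp add: mult_ac)
  qed
qed

end
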